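(* Under bilateral link formation with the smart adversary, for $n\ge 9$ and $\alpha>2$ the price of anarchy, both with respect to pairwise Nash equilibrium and with respect to pairwise stability, is $\Omega\big(1+\frac n\alpha\big)$. That is, there is an absolute constant $c>0$ such that for all integers $n\ge 9$ and all $\alpha>2$, $$\max_{S}\frac{C(S)}{\mathrm{OPT}(n,\alpha)}\;\ge\; c\Big(1+\frac n\alpha\Big),$$ where the maximum is over all pairwise Nash equilibria $S$ for $n$ players and link cost $\alpha$, and the same inequality holds when the maximum is over all pairwise stable $S$.
   Context: Players are $V=\{1,\dots,n\}$ ($n\ge 3$), link cost is $\alpha>0$. A strategy profile is a matrix $S\in\{0,1\}^{n\times n}$ with $S_{vv}=0$; for $v\ne w$, $S_{vw}=1$ means that player $v$ requests the edge $\{v,w\}$. Bilateral link formation: the final graph is the simple undirected graph $G(S)=(V,E(S))$ with $E(S)=\{\{v,w\}: S_{vw}=1 \text{ and } S_{wv}=1\}$. Optima and equilibria are taken among essential profiles only ($S_{vw}=1\Rightarrow S_{wv}=1$), so an equilibrium is determined by its final graph. $S+(v,w)$, $S-(v,w)$ denote $S$ with the entry $S_{vw}$ set to $1$, respectively $0$. For a connected graph $G=(V,E)$, $e\in E$, $v\in V$, the relevance $\mathrm{rel}_G(e,v)$ is the number of vertices that, starting at $v$, can only be reached via $e$ (so it is $0$ iff $e$ is not a bridge). Let $\mathrm{sep}(e)=\sum_{v\in V}\mathrm{rel}_G(e,v)$, $\mathrm{sep}_{\max}=\max_{e\in E}\mathrm{sep}(e)$ and $E_{\max}=\{e\in E:\mathrm{sep}(e)=\mathrm{sep}_{\max}\}$.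 The smart adversary removes one edge chosen uniformly at random from $E_{\max}$; so the disconnection cost of $v$ is $I_v(G)=\frac{1}{|E_{\max}|}\sum_{e\in E_{\max}}\mathrm{rel}_G(e,v)$ if $G$ is connected and $I_v(G)=\infty$ otherwise. Individual cost: $C_v(S)=\alpha\sum_{w}S_{vw}+I_v(G(S))$. Social cost: $C(S)=\sum_{v}C_v(S)$ ($=2\alpha|E(S)|+\sum_v I_v(G(S))$ for essential $S$). $\mathrm{OPT}(n,\alpha)$ is the minimum social cost. Consider the conditions: (a) for all $\{v,w\}\in E(S)$: $C_v(S-(v,w))\ge C_v(S)$ and $C_w(S-(w,v))\ge C_w(S)$; (b) for all $v\ne w$ with $\{v,w\}\notin E(S)$: if $C_v(S+(v,w)+(w,v))\le C_v(S)$ then $C_w(S+(v,w)+(w,v))>C_w(S)$. $S$ is pairwise stable if (a) and (b) hold. $S$ is a pairwise Nash equilibrium if (b) holds and no player $v$ can strictly decrease $C_v$ by changing her own row $S_v$ arbitrarily while the other rows stay fixed. *)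

theory Defs
  imports Complex_Main "HOL-Library.Extended_Real"
begin

section \<open>Strategy profiles and final graphs\<close>

text \<open>A profile for \<open>n\<close> players is a Boolean matrix that is false on the diagonal. Requiring it to be
  false outside \<open>{1..n} \<times> {1..n}\<close> as well makes profiles correspond one-to-one to \<open>n \<times> n\<close> matrices.\<close>

type_synonym profile = "nat \<Rightarrow> nat \<Rightarrow> bool"

definition players :: "nat \<Rightarrow> nat set" where
  "players n = {1..n}"

definition is_profile :: "nat \<Rightarrow> profile \<Rightarrow> bool" where
  "is_profile n S \<longleftrightarrow> (\<forall>v w. S v w \<longrightarrow> v \<in> players n \<and> w \<in> players n \<and> v \<noteq> w)"

definition essential :: "nat \<Rightarrow> profile \<Rightarrow> bool" where
  "essential n S \<longleftrightarrow> is_profile n S \<and> (\<forall>v w. S v w \<longrightarrow> S w v)"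

definition final_edges :: "profile \<Rightarrow> nat set set" where
  "final_edges S = {{v, w} | v w. S v w \<and> S w v}"

definition add_request :: "profile \<Rightarrow> nat \<Rightarrow> nat \<Rightarrow> profile" where
  "add_request S v w = S(v := (S v)(w := True))"

definition del_request :: "profile \<Rightarrow> nat \<Rightarrow> nat \<Rightarrow> profile" where
  "del_request S v w = S(v := (S v)(w := False))"


section \<open>The smart adversary\<close>

text \<open>Graphs on the vertex set \<^term>\<open>players n\<close> are given by their set of (two-element) edges.\<close>

definition reach :: "nat set set \<Rightarrow> (nat \<times> nat) set" where
  "reach E = {(u, w). {u, w} \<in> E}\<^sup>*"

definition graph_connected :: "nat \<Rightarrow> nat set set \<Rightarrow> bool" where
  "graph_connected n E \<longleftrightarrow> (\<forall>u \<in> players n. \<forall>w \<in> players n. (u, w) \<in> reach E)"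

definition relevance :: "nat \<Rightarrow> nat set set \<Rightarrow> nat set \<Rightarrow> nat \<Rightarrow> nat" where
  "relevance n E e v = card {w \<in> players n. (v, w) \<in> reach E \<and> (v, w) \<notin> reach (E - {e})}"

definition sep :: "nat \<Rightarrow> nat set set \<Rightarrow> nat set \<Rightarrow> nat" where
  "sep n E e = (\<Sum>v \<in> players n. relevance n E e v)"

definition sep_max :: "nat \<Rightarrow> nat set set \<Rightarrow> nat" where
  "sep_max n E = Max (sep n E ` E)"

definition E_max :: "nat \<Rightarrow> nat set set \<Rightarrow> nat set set" where
  "E_max n E = {e \<in> E. sep n E e = sep_max n E}"

definition disconnection_cost :: "nat \<Rightarrow> nat set set \<Rightarrow> nat \<Rightarrow> ereal" where
  "disconnection_cost n E v =
     (if graph_connected n E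
      then ereal (1 / real (card (E_max n E)) * (\<Sum>e \<in> E_max n E. real (relevance n E e v)))
      else \<infinity>)"


section \<open>Costs\<close>

definition individual_cost :: "nat \<Rightarrow> real \<Rightarrow> profile \<Rightarrow> nat \<Rightarrow> ereal" where
  "individual_cost n \<alpha> S v =
     ereal (\<alpha> * (\<Sum>w \<in> players n. of_bool (S v w))) + disconnection_cost n (final_edges S) v"

definition social_cost :: "nat \<Rightarrow> real \<Rightarrow> profile \<Rightarrow> ereal" where
  "social_cost n \<alpha> S = (\<Sum>v \<in> players n. individual_cost n \<alpha> S v)"

definition OPT :: "nat \<Rightarrow> real \<Rightarrow> ereal" where
  "OPT n \<alpha> = Min (social_cost n \<alpha> ` {S. essential n S})"


section \<open>Equilibria and the price of anarchy\<close>

definition no_link_severed :: "nat \<Rightarrow> real \<Rightarrow> profile \<Rightarrow> bool" where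
  "no_link_severed n \<alpha> S \<longleftrightarrow>
     (\<forall>v w. {v, w} \<in> final_edges S \<longrightarrow>
        individual_cost n \<alpha> (del_request S v w) v \<ge> individual_cost n \<alpha> S v \<and>
        individual_cost n \<alpha> (del_request S w v) w \<ge> individual_cost n \<alpha> S w)"

definition no_link_added :: "nat \<Rightarrow> real \<Rightarrow> profile \<Rightarrow> bool" where
  "no_link_added n \<alpha> S \<longleftrightarrow>
     (\<forall>v \<in> players n. \<forall>w \<in> players n. v \<noteq> w \<longrightarrow> {v, w} \<notin> final_edges S \<longrightarrow>
        individual_cost n \<alpha> (add_request (add_request S v w) w v) v \<le> individual_cost n \<alpha> S v \<longrightarrow>
        individual_cost n \<alpha> (add_request (add_request S v w) w v) w > individual_cost n \<alpha> S w)"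

definition nash :: "nat \<Rightarrow> real \<Rightarrow> profile \<Rightarrow> bool" where
  "nash n \<alpha> S \<longleftrightarrow>
     (\<forall>v \<in> players n. \<forall>r. is_profile n (S(v := r)) \<longrightarrow>
        \<not> individual_cost n \<alpha> (S(v := r)) v < individual_cost n \<alpha> S v)"

definition pairwise_stable :: "nat \<Rightarrow> real \<Rightarrow> profile \<Rightarrow> bool" where
  "pairwise_stable n \<alpha> S \<longleftrightarrow> essential n S \<and> no_link_severed n \<alpha> S \<and> no_link_added n \<alpha> S"

definition pairwise_nash :: "nat \<Rightarrow> real \<Rightarrow> profile \<Rightarrow> bool" where
  "pairwise_nash n \<alpha> S \<longleftrightarrow> essential n S \<and> nash n \<alpha> S \<and> no_link_added n \<alpha> S"

text \<open>The supremum ranges over a finite set, so it is a maximum as soon as an equilibrium exists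
  (see below); if there is none it is \<open>- \<infinity>\<close>. A real lower bound on the price of anarchy thus
  includes the existence of an equilibrium.\<close>

definition price_of_anarchy ::
    "(nat \<Rightarrow> real \<Rightarrow> profile \<Rightarrow> bool) \<Rightarrow> nat \<Rightarrow> real \<Rightarrow> ereal" where
  "price_of_anarchy equilibrium n \<alpha> =
     (SUP S \<in> {S. equilibrium n \<alpha> S}. social_cost n \<alpha> S / OPT n \<alpha>)"

lemma finite_essential: "finite {S. essential n S}"
proof (rule finite_subset)
  let ?f = "\<lambda>R v w. (v, w) \<in> (R :: (nat \<times> nat) set)"
  show "{S. essential n S} \<subseteq> ?f ` Pow (players n \<times> players n)"
  proof
    fix S assume "S \<in> {S. essential n S}"
    then have "{(v, w). S v w} \<in> Pow (players n \<times> players n)"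
      by (auto simp: essential_def is_profile_def)
    moreover have "S = ?f {(v, w). S v w}" by simp
    ultimately show "S \<in> ?f ` Pow (players n \<times> players n)" by blast
  qed
  show "finite (?f ` Pow (players n \<times> players n))" by (simp add: players_def)
qed

lemma price_of_anarchy_eq_Max:
  assumes "equilibrium = pairwise_nash \<or> equilibrium = pairwise_stable"
    and "{S. equilibrium n \<alpha> S} \<noteq> {}"
  shows "price_of_anarchy equilibrium n \<alpha> =
    Max ((\<lambda>S. social_cost n \<alpha> S / OPT n \<alpha>) ` {S. equilibrium n \<alpha> S})"
proof -
  have "finite {S. equilibrium n \<alpha> S}"
    using assms(1) by (intro finite_subset[OF _ finite_essential[of n]])
      (auto simp: pairwise_nash_def pairwise_stable_def)
  then show ?thesis
    unfolding price_of_anarchy_def using assms(2) by (intro Max_Sup[symmetric]) auto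
qed

end

theory Submission
  imports Defs
begin

text \<open>Consider a tree whose root is joined to the centres of three stars with \<open>b + 1\<close>, \<open>b\<close> and \<open>b\<close>
  vertices and to further leaves, where \<open>b\<close> is about \<open>n / 3\<close>. The adversary always removes the edge
  to the largest star, which separates \<open>\<Theta>(n\<^sup>2)\<close> pairs. A link that does not bypass this edge is
  useless. If a link bypasses it, the adversary turns to an edge to another star, and since any edge
  separating as many pairs cuts off at least \<open>b\<close> vertices from every player, the endpoint outside the
  largest star gains at most \<open>1 < \<alpha>\<close>. Every edge of a tree is indispensable, so the tree is an
  equilibrium, whereas a star costs only \<open>O(\<alpha>n)\<close>.\<close>

section \<open>Reachability and separation\<close>

lemma reach_refl [simp]: "(u, u) \<in> reach E"
  by (simp add: reach_def)

lemma reach_edge: "{u, w} \<in> E \<Longrightarrow> (u, w) \<in> reach E"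
  by (auto simp: reach_def)

lemma reach_sym: "(u, w) \<in> reach E \<Longrightarrow> (w, u) \<in> reach E"
proof -
  have "sym {(u, w). {u, w} \<in> E}"
    by (auto simp: sym_def insert_commute)
  then show "(u, w) \<in> reach E \<Longrightarrow> (w, u) \<in> reach E"
    unfolding reach_def by (meson sym_rtrancl symD)
qed

lemma reach_trans: "(u, v) \<in> reach E \<Longrightarrow> (v, w) \<in> reach E \<Longrightarrow> (u, w) \<in> reach E"
  unfolding reach_def by (rule rtrancl_trans)

lemma reach_mono: "E \<subseteq> F \<Longrightarrow> reach E \<subseteq> reach F"
  unfolding reach_def by (rule rtrancl_mono) auto

lemma reach_closed:
  assumes "(u, w) \<in> reach E" and "u \<in> X"
    and closed: "\<And>x y. {x, y} \<in> E \<Longrightarrow> x \<in> X \<Longrightarrow> y \<in> X"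
  shows "w \<in> X"
  using assms(1,2) unfolding reach_def by (induction rule: rtrancl_induct) (auto intro: closed)

text \<open>A path from \<open>u\<close> either avoids \<open>e\<close> or, just before it first
  uses \<open>e\<close>, stands at an endpoint of \<open>e\<close> that was reached without
  it.\<close>

lemma reach_remove_edge:
  assumes "(u, w) \<in> reach E"
  shows "(u, w) \<in> reach (E - {e}) \<or> (\<exists>c \<in> e. (u, c) \<in> reach (E - {e}))"
  using assms unfolding reach_def[of E]
proof (induction rule: rtrancl_induct)
  case (step y z)
  then consider "(u, y) \<in> reach (E - {e})" | "\<exists>c \<in> e. (u, c) \<in> reach (E - {e})"
    by blast
  then show ?case
  proof cases
    case 1
    show ?thesis
    proof (cases "{y, z} = e")
      case False
      then show ?thesis
        using 1 step.hyps reach_edge[of y z "E - {e}"] by (auto intro: reach_trans)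
    qed (use 1 in auto)
  qed blast
qed simp

lemma graph_connectedI:
  assumes "\<And>u. u \<in> players n \<Longrightarrow> (r, u) \<in> reach E"
  shows "graph_connected n E"
  using assms unfolding graph_connected_def by (blast intro: reach_sym reach_trans)

lemma graph_connected_mono: "graph_connected n E \<Longrightarrow> E \<subseteq> F \<Longrightarrow> graph_connected n F"
  unfolding graph_connected_def using reach_mono by blast

section \<open>Relevance of an edge and the number of separated pairs\<close>

lemma finite_players [simp]: "finite (players n)"
  by (simp add: players_def)

lemma card_players [simp]: "card (players n) = n"
  by (simp add: players_def)

lemma relevance_connected:
  assumes "graph_connected n E" and "v \<in> players n"
  shows "relevance n E e v = card {w \<in> players n. (v, w) \<notin> reach (E - {e})}"
proof -
  have "{w \<in> players n. (v, w) \<in> reach E \<and> (v, w) \<notin> reach (E - {e})} =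
      {w \<in> players n. (v, w) \<notin> reach (E - {e})}"
    using assms unfolding graph_connected_def by blast
  then show ?thesis
    by (simp add: relevance_def)
qed

lemma relevance_antimono:
  assumes "graph_connected n E" and "E \<subseteq> F" and "v \<in> players n"
  shows "relevance n F e v \<le> relevance n E e v"
proof -
  have "reach (E - {e}) \<subseteq> reach (F - {e})"
    using assms(2) by (intro reach_mono) auto
  then show ?thesis
    using assms graph_connected_mono[OF assms(1,2)]
    by (auto simp: relevance_connected intro!: card_mono)
qed

lemma relevance_cong:
  assumes "graph_connected n E" and "u \<in> players n" "v \<in> players n"
    and "(u, v) \<in> reach (E - {e})"
  shows "relevance n E e u = relevance n E e v"
proof -
  have "(u, w) \<in> reach (E - {e}) \<longleftrightarrow> (v, w) \<in> reach (E - {e})" for w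
    using assms(4) by (blast intro: reach_sym reach_trans)
  then show ?thesis
    using assms by (simp add: relevance_connected)
qed

text \<open>The set \<open>X\<close> is a union of components once \<open>e\<close> is gone, so a
  player outside \<open>X\<close> loses all of it.\<close>

lemma relevance_ge_cut:
  assumes "graph_connected n E" and "v \<in> players n" "v \<notin> X" "X \<subseteq> players n"
    and "\<And>x y. {x, y} \<in> E - {e} \<Longrightarrow> x \<in> X \<Longrightarrow> y \<in> X"
  shows "card X \<le> relevance n E e v"
proof -
  have "(v, w) \<notin> reach (E - {e})" if "w \<in> X" for w
    using reach_closed[of w v "E - {e}" X] reach_sym that assms(3,5) by blast
  then show ?thesis
    using assms by (auto simp: relevance_connected intro!: card_mono)
qed

text \<open>Deleting one edge leaves at most two components, and the relevance for a player is the size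
  of the component not containing her.\<close>

lemma sep_eq:
  assumes conn: "graph_connected n E" and e: "e = {a, b}" and v: "v \<in> players n"
  shows "sep n E e = 2 * relevance n E e v * (n - relevance n E e v)"
proof -
  let ?R = "reach (E - {e})"
  define A where "A = {w \<in> players n. (v, w) \<in> ?R}"
  define B where "B = {w \<in> players n. (v, w) \<notin> ?R}"
  have AB: "A \<union> B = players n" "A \<inter> B = {}"
    by (auto simp: A_def B_def)
  have fin: "finite A" "finite B"
    by (auto simp: A_def B_def)
  \<comment> \<open>If \<open>B\<close> is nonempty, no \<open>u\<close> reaches both
    \<open>v\<close> and a vertex \<open>w\<close> of \<open>B\<close> without \<open>e\<close>. Its
    path to one of them therefore needs \<open>e\<close>, so an endpoint of \<open>e\<close> is
    reachable before that.\<close>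
  have end_point: "(u, a) \<in> ?R \<or> (u, b) \<in> ?R" if "B \<noteq> {}" "u \<in> players n" for u
  proof -
    from that(1) obtain w where w: "w \<in> players n" "(v, w) \<notin> ?R"
      by (auto simp: B_def)
    have "(u, v) \<notin> ?R \<or> (u, w) \<notin> ?R"
      using w(2) by (blast intro: reach_sym reach_trans)
    moreover have "(u, v) \<in> reach E" "(u, w) \<in> reach E"
      using conn w v that(2) by (auto simp: graph_connected_def)
    ultimately show ?thesis
      using reach_remove_edge[of u _ E e] e by blast
  qed
  \<comment> \<open>The player \<open>v\<close> reaches one endpoint of \<open>e\<close>. Vertices
    of \<open>B\<close> cannot reach that one, so all of them reach the other, which makes
    \<open>B\<close> a single component.\<close>
  have B_class: "(u, w) \<in> ?R" if "u \<in> B" "w \<in> B" for u w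
  proof -
    have "v \<in> players n" "u \<in> players n" "w \<in> players n" "(v, u) \<notin> ?R" "(v, w) \<notin> ?R"
      using that v by (auto simp: B_def)
    with end_point[of v] end_point[of u] end_point[of w] that(1) show ?thesis
      by (metis empty_iff reach_sym reach_trans)
  qed
  have rel: "relevance n E e u = card (if u \<in> A then B else A)" if "u \<in> players n" for u
  proof -
    have "{w \<in> players n. (u, w) \<notin> ?R} = (if u \<in> A then B else A)"
    proof (cases "u \<in> A")
      case True
      then show ?thesis
        by (auto simp: A_def B_def intro: reach_sym reach_trans)
    next
      case False
      then have "u \<in> B"
        using that AB by blast
      then show ?thesis
        using False B_class by (auto simp: A_def B_def intro: reach_sym reach_trans)
    qed
    then show ?thesis
      using relevance_connected[OF conn that] by simp
  qed
  have "sep n E e = (\<Sum>u \<in> A \<union> B. relevance n E e u)"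
    by (simp add: sep_def AB)
  also have "\<dots> = (\<Sum>u \<in> A. relevance n E e u) + (\<Sum>u \<in> B. relevance n E e u)"
    using fin AB by (intro sum.union_disjoint) auto
  also have "(\<Sum>u \<in> A. relevance n E e u) = (\<Sum>u \<in> A. card B)"
    using AB(1) by (intro sum.cong refl) (subst rel; auto)
  also have "(\<Sum>u \<in> B. relevance n E e u) = (\<Sum>u \<in> B. card A)"
    using AB by (intro sum.cong refl) (subst rel; auto)
  finally have "sep n E e = 2 * card B * card A"
    by simp
  moreover have "relevance n E e v = card B"
    using v by (simp add: rel A_def)
  moreover have "n = card A + card B"
    using card_Un_disjoint[OF fin AB(2)] AB(1) by simp
  ultimately show ?thesis
    by simp
qed

text \<open>The difference of the two sides is \<open>(y - x) * (n - x - y)\<close>, which appears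
  below as \<open>d * k\<close>. It expresses that more balanced cuts separate more pairs.\<close>

lemma mult_diff_strict_mono:
  fixes x y n :: nat
  assumes "x < y" and "x + y < n"
  shows "x * (n - x) < y * (n - y)"
proof -
  obtain d where d: "y = x + d" "d > 0"
    using assms(1) less_imp_add_positive by blast
  obtain k where k: "n = 2 * x + d + k" "k > 0"
    using assms(2) d less_imp_add_positive[of "x + y" n] by auto
  have "x * (n - x) + d * k = y * (n - y)"
    using d k by (simp add: algebra_simps)
  moreover have "d * k > 0"
    using d k by simp
  ultimately show ?thesis
    by linarith
qed


section \<open>Costs\<close>

lemma E_max_nonempty:
  assumes "finite E" "E \<noteq> {}"
  shows "finite (E_max n E)" "E_max n E \<noteq> {}"
proof -
  show "finite (E_max n E)"
    using assms by (simp add: E_max_def)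
  have "sep_max n E \<in> sep n E ` E"
    unfolding sep_max_def using assms by (intro Max_in) auto
  then show "E_max n E \<noteq> {}"
    by (auto simp: E_max_def)
qed

lemma sep_le_E_max: "finite E \<Longrightarrow> e \<in> E \<Longrightarrow> f \<in> E_max n E \<Longrightarrow> sep n E e \<le> sep n E f"
  by (simp add: E_max_def sep_max_def)

lemma E_max_unique:
  assumes "finite E" "e \<in> E" and "\<And>f. f \<in> E \<Longrightarrow> f \<noteq> e \<Longrightarrow> sep n E f < sep n E e"
  shows "E_max n E = {e}"
proof -
  have "E_max n E \<subseteq> {e}"
    using sep_le_E_max[OF assms(1,2)] assms(3) by (fastforce simp: E_max_def)
  then show ?thesis
    using E_max_nonempty(2)[of E n] assms(1,2) by blast
qed

lemma disconnection_cost_unique: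
  assumes "graph_connected n E" "E_max n E = {e}"
  shows "disconnection_cost n E v = ereal (real (relevance n E e v))"
  using assms by (simp add: disconnection_cost_def)

lemma disconnection_cost_nonneg: "0 \<le> disconnection_cost n E v"
  by (auto simp: disconnection_cost_def intro!: divide_nonneg_nonneg sum_nonneg)

text \<open>An edge cutting off fewer than \<open>k\<close> vertices from \<open>v\<close> separates
  fewer pairs than \<open>e\<close>, because \<open>2 * k \<le> n\<close>, and is thus no target.
  Every target costs \<open>v\<close> at least \<open>k\<close>, hence so does the average. The
  target edges themselves need not be known.\<close>

lemma disconnection_cost_ge:
  assumes conn: "graph_connected n E" and fin: "finite E" and v: "v \<in> players n"
    and graph: "\<And>f. f \<in> E \<Longrightarrow> \<exists>a b. f = {a, b}"
    and e: "e \<in> E" "2 * k * (n - k) \<le> sep n E e" and k: "2 * k \<le> n"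
  shows "ereal (real k) \<le> disconnection_cost n E v"
proof -
  have nonempty: "E \<noteq> {}"
    using e(1) by blast
  have ge: "k \<le> relevance n E f v" if f: "f \<in> E_max n E" for f
  proof (rule ccontr)
    let ?x = "relevance n E f v"
    assume "\<not> k \<le> ?x"
    then have "?x * (n - ?x) < k * (n - k)"
      using k by (intro mult_diff_strict_mono) auto
    moreover have "sep n E f = 2 * ?x * (n - ?x)"
      using sep_eq[OF conn _ v, of f] graph[of f] f by (auto simp: E_max_def)
    ultimately show False
      using sep_le_E_max[OF fin e(1) f] e(2) by simp
  qed
  have "real (card (E_max n E)) * real k = (\<Sum>f \<in> E_max n E. real k)"
    by simp
  also have "\<dots> \<le> (\<Sum>f \<in> E_max n E. real (relevance n E f v))"
    using ge by (intro sum_mono) auto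
  finally have "real k \<le> 1 / real (card (E_max n E)) *
      (\<Sum>f \<in> E_max n E. real (relevance n E f v))"
    using E_max_nonempty[OF fin nonempty, of n] by (auto simp: field_simps card_gt_0_iff)
  then show ?thesis
    using conn by (simp add: disconnection_cost_def)
qed

text \<open>Exchanging the sums turns the total into the average of \<open>sep\<close> over
  \<open>E_max\<close>, where \<open>sep\<close> is constant.\<close>

lemma sum_disconnection_cost:
  assumes "graph_connected n E" "finite E" "E \<noteq> {}"
  shows "(\<Sum>v \<in> players n. disconnection_cost n E v) = ereal (real (sep_max n E))"
proof -
  have "(\<Sum>v \<in> players n. \<Sum>e \<in> E_max n E. real (relevance n E e v)) =
      (\<Sum>e \<in> E_max n E. \<Sum>v \<in> players n. real (relevance n E e v))"
    by (rule sum.swap)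
  also have "\<dots> = (\<Sum>e \<in> E_max n E. real (sep_max n E))"
    by (intro sum.cong refl) (simp add: E_max_def sep_def flip: of_nat_sum)
  finally show ?thesis
    using assms E_max_nonempty[OF assms(2,3), of n]
    by (simp add: disconnection_cost_def flip: sum_divide_distrib)
qed

section \<open>Social cost and the optimum\<close>

lemma social_cost_nonneg:
  assumes "0 \<le> \<alpha>"
  shows "0 \<le> social_cost n \<alpha> S"
  unfolding social_cost_def individual_cost_def using assms
  by (intro sum_nonneg add_nonneg_nonneg disconnection_cost_nonneg) (auto intro!: mult_nonneg_nonneg sum_nonneg)

lemma social_cost_eq:
  assumes "graph_connected n (final_edges S)" "finite (final_edges S)" "final_edges S \<noteq> {}"
    and "is_profile n S"
  shows "social_cost n \<alpha> S =
    ereal (\<alpha> * real (card {(v, w). S v w}) + real (sep_max n (final_edges S)))"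
proof -
  have "{(v, w). S v w} = (SIGMA v:players n. {w \<in> players n. S v w})"
    using assms(4) by (auto simp: is_profile_def)
  then have "card {(v, w). S v w} = (\<Sum>v \<in> players n. card {w \<in> players n. S v w})"
    by simp
  then have requests: "(\<Sum>v \<in> players n. \<Sum>w \<in> players n. of_bool (S v w)) =
      real (card {(v, w). S v w})"
    by (simp add: Int_def)
  have "social_cost n \<alpha> S = (\<Sum>v \<in> players n. ereal (\<alpha> * (\<Sum>w \<in> players n. of_bool (S v w)))) +
      ereal (real (sep_max n (final_edges S)))"
    by (simp only: social_cost_def individual_cost_def sum.distrib
        sum_disconnection_cost[OF assms(1-3)])
  then show ?thesis
    by (simp only: sum_ereal requests plus_ereal.simps flip: sum_distrib_left)
qed

lemma OPT_le:
  assumes "essential n S"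
  shows "OPT n \<alpha> \<le> social_cost n \<alpha> S"
  unfolding OPT_def using assms finite_essential by (intro Min_le) auto

lemma OPT_nonneg:
  assumes "0 \<le> \<alpha>" and "essential n S"
  shows "0 \<le> OPT n \<alpha>"
proof -
  have "OPT n \<alpha> \<in> social_cost n \<alpha> ` {S. essential n S}"
    unfolding OPT_def using assms(2) finite_essential by (intro Min_in) auto
  then show ?thesis
    using social_cost_nonneg[OF assms(1)] by auto
qed

lemma price_of_anarchy_ge:
  assumes "equilibrium n \<alpha> S" and "ereal C \<le> social_cost n \<alpha> S"
    and "essential n T" and "social_cost n \<alpha> T \<le> ereal D"
    and "0 < \<alpha>" "0 \<le> C" "0 < D"
  shows "ereal (C / D) \<le> price_of_anarchy equilibrium n \<alpha>"
proof -
  have "OPT n \<alpha> \<le> ereal D"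
    using OPT_le[OF assms(3), of \<alpha>] assms(4) by (rule order_trans)
  \<comment> \<open>In \<open>ereal\<close> the inverse of 0 is infinity, so inversion is antitone
    on all nonnegative values.\<close>
  then have "inverse (ereal D) \<le> inverse (OPT n \<alpha>)"
    using OPT_nonneg[of \<alpha> n T] assms by (intro ereal_inverse_antimono) auto
  then have "ereal C * inverse (ereal D) \<le> social_cost n \<alpha> S * inverse (OPT n \<alpha>)"
    using assms by (intro ereal_mult_mono) (auto simp: social_cost_nonneg)
  then have "ereal (C / D) \<le> social_cost n \<alpha> S / OPT n \<alpha>"
    using assms(7) by (simp add: divide_ereal_def divide_inverse)
  also have "\<dots> \<le> price_of_anarchy equilibrium n \<alpha>"
    unfolding price_of_anarchy_def using assms(1) by (intro SUP_upper) auto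
  finally show ?thesis .
qed


section \<open>Trees as equilibria\<close>

lemma final_edges_iff: "{v, w} \<in> final_edges S \<longleftrightarrow> S v w \<and> S w v"
  by (auto simp: final_edges_def doubleton_eq_iff)

text \<open>Withdrawing a single request is a special case of changing one's row.\<close>

lemma pairwise_nash_imp_stable:
  assumes "pairwise_nash n \<alpha> S"
  shows "pairwise_stable n \<alpha> S"
proof -
  have S: "is_profile n S" "nash n \<alpha> S"
    using assms by (auto simp: pairwise_nash_def essential_def)
  have sever: "individual_cost n \<alpha> S v \<le> individual_cost n \<alpha> (del_request S v w) v"
    if "S v w" for v w
  proof -
    have "is_profile n (S(v := (S v)(w := False)))"
      using S(1) unfolding is_profile_def by (auto split: if_splits)
    moreover have "v \<in> players n"
      using S(1) that by (auto simp: is_profile_def)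
    ultimately show ?thesis
      using S(2) unfolding nash_def del_request_def by (metis not_less)
  qed
  then have "no_link_severed n \<alpha> S"
    unfolding no_link_severed_def final_edges_iff by blast
  then show ?thesis
    using assms by (simp add: pairwise_nash_def pairwise_stable_def)
qed

text \<open>A deviating player cannot create links alone, as no unanswered request is waiting in an
  essential profile. Withdrawing a request destroys a bridge and costs infinity; keeping all
  requests leaves the graph unchanged and saves nothing.\<close>

lemma nash_if_all_bridges:
  assumes ess: "essential n S" and conn: "graph_connected n (final_edges S)" and \<alpha>: "0 \<le> \<alpha>"
    and bridge: "\<And>e. e \<in> final_edges S \<Longrightarrow> \<not> graph_connected n (final_edges S - {e})"
  shows "nash n \<alpha> S"
  unfolding nash_def
proof (intro ballI allI impI)
  fix v r
  let ?T = "S(v := r)"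
  assume T: "is_profile n ?T"
  have sub: "final_edges ?T \<subseteq> final_edges S"
  proof
    fix e assume "e \<in> final_edges ?T"
    then obtain x y where xy: "e = {x, y}" "?T x y" "?T y x"
      unfolding final_edges_def by blast
    have "x \<noteq> y"
      using T xy(2) unfolding is_profile_def by blast
    then have "S x y \<or> S y x"
      using xy(2,3) by (cases "x = v") auto
    then have "S x y \<and> S y x"
      using ess by (auto simp: essential_def)
    then show "e \<in> final_edges S"
      using xy(1) by (auto simp: final_edges_def)
  qed
  show "\<not> individual_cost n \<alpha> ?T v < individual_cost n \<alpha> S v"
  proof (cases "\<exists>w. S v w \<and> \<not> r w")
    case True
    then obtain w where w: "S v w" "\<not> r w"
      by blast
    then have vw: "{v, w} \<in> final_edges S" "{v, w} \<notin> final_edges ?T"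
      using ess by (simp_all add: final_edges_iff essential_def)
    from vw(2) sub have "final_edges ?T \<subseteq> final_edges S - {{v, w}}"
      by blast
    then have "\<not> graph_connected n (final_edges ?T)"
      using bridge[OF vw(1)] graph_connected_mono by metis
    then show ?thesis
      by (simp add: individual_cost_def disconnection_cost_def)
  next
    case False
    then have "?T x y" if "S x y" for x y
      using that by (cases "x = v") auto
    then have "final_edges S \<subseteq> final_edges ?T"
      unfolding final_edges_def by blast
    with sub have "final_edges ?T = final_edges S"
      by blast
    moreover have "(\<Sum>w \<in> players n. of_bool (S v w)) \<le>
        (\<Sum>w \<in> players n. of_bool (?T v w) :: real)"
      using False by (intro sum_mono) auto
    ultimately show ?thesis
      using \<alpha> by (auto simp: individual_cost_def not_less intro!: add_right_mono mult_left_mono)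
  qed
qed

lemma final_edges_add_link:
  assumes "essential n S" "v \<noteq> w"
  shows "final_edges (add_request (add_request S v w) w v) = insert {v, w} (final_edges S)"
proof -
  have "add_request (add_request S v w) w v x y \<longleftrightarrow> S x y \<or> {x, y} = {v, w}" for x y
    using assms(2) by (auto simp: add_request_def doubleton_eq_iff)
  then have "final_edges (add_request (add_request S v w) w v) =
      {{x, y} | x y. (S x y \<or> {x, y} = {v, w}) \<and> (S y x \<or> {x, y} = {v, w})}"
    by (simp add: final_edges_def insert_commute)
  also have "\<dots> = insert {v, w} (final_edges S)"
    using assms(1) by (auto simp: final_edges_def essential_def)
  finally show ?thesis .
qed

text \<open>An endpoint of a new link pays \<alpha> more, so the link is a loss whenever it saves
  less than \<alpha> in disconnection cost. The real bounds \<open>c\<close> and \<open>d\<close>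
  avoid exact values of the cost after the change.\<close>

lemma individual_cost_add_link:
  assumes ess: "essential n S" and vw: "v \<noteq> w" "v \<in> players n" "w \<in> players n"
    and new: "{v, w} \<notin> final_edges S" and u: "u \<in> {v, w}"
    and old_cost: "disconnection_cost n (final_edges S) u \<le> ereal c"
    and new_cost: "ereal d \<le> disconnection_cost n (insert {v, w} (final_edges S)) u"
    and "c < d + \<alpha>"
  shows "individual_cost n \<alpha> S u <
    individual_cost n \<alpha> (add_request (add_request S v w) w v) u"
proof -
  let ?T = "add_request (add_request S v w) w v"
  obtain x where x: "{u, x} = {v, w}" "u \<noteq> x" "x \<in> players n"
    using u vw by (auto simp: insert_commute)
  have nS: "\<not> S u x"
    using new ess x(1) final_edges_iff[of u x S] by (auto simp: essential_def)
  have "?T u = (S u)(x := True)"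
    using x vw by (auto simp: add_request_def doubleton_eq_iff)
  then have "(\<Sum>y \<in> players n. of_bool (?T u y)) =
      (\<Sum>y \<in> players n. of_bool (S u y) + of_bool (y = x) :: real)"
    using nS by (intro sum.cong) auto
  also have "\<dots> = (\<Sum>y \<in> players n. of_bool (S u y)) + 1"
    using x(3) by (simp add: sum.distrib of_bool_def)
  finally have requests: "(\<Sum>y \<in> players n. of_bool (?T u y)) =
      (\<Sum>y \<in> players n. of_bool (S u y)) + (1 :: real)" .
  let ?s = "\<Sum>y \<in> players n. of_bool (S u y) :: real"
  have "individual_cost n \<alpha> S u \<le> ereal (\<alpha> * ?s) + ereal c"
    unfolding individual_cost_def using old_cost by (intro add_left_mono)
  also have "\<dots> < ereal (\<alpha> * (?s + 1)) + ereal d"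
    using assms(9) by (simp add: algebra_simps)
  also have "\<dots> \<le> individual_cost n \<alpha> ?T u"
    unfolding individual_cost_def requests final_edges_add_link[OF ess vw(1)]
    using new_cost by (intro add_left_mono)
  finally show ?thesis .
qed

text \<open>A rooted tree given by its parent function. The root 1 is its own parent, so the
  condition on grandparents also covers children of the root and says that the depth is at most
  two.\<close>

locale shallow_tree =
  fixes n :: nat and p :: "nat \<Rightarrow> nat"
  assumes n_ge: "2 \<le> n"
    and parent_root: "p 1 = 1"
    and parent: "\<And>u. u \<in> {2..n} \<Longrightarrow> 1 \<le> p u \<and> p u < u"
    and grandparent: "\<And>u. u \<in> {2..n} \<Longrightarrow> p (p u) = 1"
begin

definition tree :: profile where
  "tree v w \<longleftrightarrow> (v \<in> {2..n} \<and> w = p v) \<or> (w \<in> {2..n} \<and> v = p w)"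

definition edges :: "nat set set" where
  "edges = (\<lambda>u. {u, p u}) ` {2..n}"

text \<open>For \<open>v\<close> in \<open>{2..n}\<close> this is the whole subtree below
  \<open>v\<close>, since depth two leaves no room for grandchildren of \<open>v\<close>.\<close>

definition branch :: "nat \<Rightarrow> nat set" where
  "branch v = {u \<in> players n. u = v \<or> p u = v}"

section \<open>Bridges and cuts of a tree of depth two\<close>

lemma essential_tree: "essential n tree"
  unfolding essential_def is_profile_def tree_def players_def using parent by fastforce

lemma final_edges_tree: "final_edges tree = edges"
proof -
  have "final_edges tree = {{v, w} | v w. tree v w}"
    using essential_tree by (auto simp: final_edges_def essential_def)
  also have "\<dots> = edges"
  proof
    show "{{v, w} | v w. tree v w} \<subseteq> edges"
      by (auto simp: tree_def edges_def insert_commute)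
    have "tree u (p u)" if "u \<in> {2..n}" for u
      using that by (simp add: tree_def)
    then show "edges \<subseteq> {{v, w} | v w. tree v w}"
      unfolding edges_def by blast
  qed
  finally show ?thesis .
qed

lemma edges_nonempty: "finite edges" "edges \<noteq> {}"
  using n_ge by (auto simp: edges_def)

lemma edge_eq_iff:
  assumes "u \<in> {2..n}" "v \<in> {2..n}"
  shows "{u, p u} = {v, p v} \<longleftrightarrow> u = v"
  using parent[OF assms(1)] parent[OF assms(2)] by (auto simp: doubleton_eq_iff)

lemma card_requests: "card {(v, w). tree v w} = 2 * (n - 1)"
proof -
  let ?A = "(\<lambda>v. (v, p v)) ` {2..n}" and ?B = "(\<lambda>v. (p v, v)) ` {2..n}"
  have "{(v, w). tree v w} = ?A \<union> ?B"
    by (auto simp: tree_def)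
  moreover have "?A \<inter> ?B = {}"
  proof -
    have "v \<noteq> p w \<or> p v \<noteq> w" if "v \<in> {2..n}" "w \<in> {2..n}" for v w
      using parent[OF that(1)] parent[OF that(2)] by auto
    then show ?thesis
      by blast
  qed
  moreover have "card ?A = n - 1" "card ?B = n - 1"
    by (subst card_image; auto simp: inj_on_def)+
  ultimately show ?thesis
    by (simp add: card_Un_disjoint)
qed

text \<open>The path from \<open>u\<close> to the root consists of at most the parent links of
  \<open>u\<close> and of \<open>p u\<close>. It contains the parent link of \<open>v\<close> only
  if \<open>u = v\<close> or \<open>p u = v\<close>.\<close>

lemma reach_root:
  assumes u: "u \<in> players n" and v: "v \<in> {2..n}" and "u \<notin> branch v"
  shows "(1, u) \<in> reach (edges - {{v, p v}})"
proof -
  have step: "(p w, w) \<in> reach (edges - {{v, p v}})" if "w \<in> {2..n}" "w \<noteq> v" for w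
    using that v edge_eq_iff[of w v]
    by (intro reach_edge) (auto simp: edges_def insert_commute)
  show ?thesis
  proof (cases "u = 1")
    case False
    then have u2: "u \<in> {2..n}"
      using u by (auto simp: players_def)
    have "u \<noteq> v" "p u \<noteq> v"
      using assms by (auto simp: branch_def)
    have "(1, p u) \<in> reach (edges - {{v, p v}})"
    proof (cases "p u = 1")
      case False
      then have "p u \<in> {2..n}"
        using parent[OF u2] u2 by auto
      then show ?thesis
        using step[of "p u"] grandparent[OF u2] \<open>p u \<noteq> v\<close> by simp
    qed simp
    then show ?thesis
      using step[OF u2 \<open>u \<noteq> v\<close>] by (rule reach_trans)
  qed simp
qed

text \<open>For a link between \<open>u\<close> and \<open>p u\<close> with
  \<open>u \<noteq> v\<close>, both ends lie in the branch exactly if \<open>p u = v\<close>: the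
  alternative \<open>p (p u) = v\<close> fails because the grandparent is the root.\<close>

lemma branch_closed:
  assumes v: "v \<in> {2..n}" and e: "{x, y} \<in> edges - {{v, p v}}"
  shows "x \<in> branch v \<longleftrightarrow> y \<in> branch v"
proof -
  obtain u where u: "{x, y} = {u, p u}" "u \<in> {2..n}"
    using e unfolding edges_def by blast
  have "u \<noteq> v"
  proof
    assume "u = v"
    then show False
      using e unfolding u(1) by blast
  qed
  have "u \<in> players n" "p u \<in> players n"
    using u(2) parent[OF u(2)] by (auto simp: players_def)
  moreover have "p (p u) \<noteq> v"
    using v grandparent[OF u(2)] by simp
  ultimately have "u \<in> branch v \<longleftrightarrow> p u \<in> branch v"
    using \<open>u \<noteq> v\<close> unfolding branch_def by blast
  moreover have "x = u \<and> y = p u \<or> x = p u \<and> y = u"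
    using u(1) by (simp only: doubleton_eq_iff)
  ultimately show ?thesis
    by blast
qed

lemma connected: "graph_connected n edges"
proof (rule graph_connectedI)
  fix u assume u: "u \<in> players n"
  have step: "(p w, w) \<in> reach edges" if "w \<in> players n" for w
  proof (cases "w = 1")
    case True
    then show ?thesis using parent_root by simp
  next
    case False
    then show ?thesis
      using that by (intro reach_edge) (auto simp: edges_def players_def insert_commute)
  qed
  show "(1, u) \<in> reach edges"
  proof (cases "u = 1")
    case False
    then have u2: "u \<in> {2..n}"
      using u by (auto simp: players_def)
    then have "p u \<in> players n"
      using parent[OF u2] by (auto simp: players_def)
    from reach_trans[OF step[OF this] step[OF u]] show ?thesis
      using grandparent[OF u2] by simp
  qed simp
qed

lemma root: "1 \<in> players n" "v \<in> {2..n} \<Longrightarrow> 1 \<notin> branch v"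
  using n_ge parent_root by (auto simp: players_def branch_def)

lemma branch_subset: "branch v \<subseteq> players n"
  by (auto simp: branch_def)

lemma bridge:
  assumes "e \<in> edges"
  shows "\<not> graph_connected n (edges - {e})"
proof
  assume conn: "graph_connected n (edges - {e})"
  obtain v where v: "e = {v, p v}" "v \<in> {2..n}"
    using assms by (auto simp: edges_def)
  have "v \<in> players n" "v \<in> branch v"
    using v(2) by (auto simp: branch_def players_def)
  then show False
    using reach_closed[of v 1 "edges - {e}" "branch v"] conn root v branch_closed[OF v(2)]
    by (auto simp: graph_connected_def)
qed

lemma relevance_root:
  assumes v: "v \<in> {2..n}" and F: "edges \<subseteq> F"
    and "\<And>x y. {x, y} \<in> F - {{v, p v}} \<Longrightarrow> x \<in> branch v \<Longrightarrow> y \<in> branch v"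
  shows "relevance n F {v, p v} 1 = card (branch v)"
proof (rule antisym)
  have "relevance n F {v, p v} 1 \<le> relevance n edges {v, p v} 1"
    by (rule relevance_antimono[OF connected F root(1)])
  also have "\<dots> \<le> card (branch v)"
    using reach_root[OF _ v] root(1) branch_subset finite_subset[OF branch_subset]
    by (auto simp: relevance_connected[OF connected] intro!: card_mono)
  finally show "relevance n F {v, p v} 1 \<le> card (branch v)" .
  show "card (branch v) \<le> relevance n F {v, p v} 1"
    using assms connected root branch_subset
    by (intro relevance_ge_cut) (auto intro: graph_connected_mono)
qed

lemma sep_branch:
  assumes v: "v \<in> {2..n}" and F: "edges \<subseteq> F"
    and "\<And>x y. {x, y} \<in> F - {{v, p v}} \<Longrightarrow> x \<in> branch v \<Longrightarrow> y \<in> branch v"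
  shows "sep n F {v, p v} = 2 * card (branch v) * (n - card (branch v))"
  using sep_eq[OF graph_connected_mono[OF connected F] refl root(1), of v "p v"]
    relevance_root[OF assms] by simp

lemma sep_edge:
  assumes "v \<in> {2..n}"
  shows "sep n edges {v, p v} = 2 * card (branch v) * (n - card (branch v))"
  using assms branch_closed by (intro sep_branch) auto

text \<open>Without the edge, \<open>u\<close> lies in the component of the root.\<close>

lemma relevance_outside:
  assumes "v \<in> {2..n}" "u \<in> players n" "u \<notin> branch v"
  shows "relevance n edges {v, p v} u = card (branch v)"
  using relevance_cong[OF connected root(1) assms(2) reach_root[OF assms(2,1,3)]]
    relevance_root[OF assms(1) order_refl] branch_closed[OF assms(1)] by simp

lemma nash_tree: "0 \<le> \<alpha> \<Longrightarrow> nash n \<alpha> tree"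
  using essential_tree connected bridge
  by (intro nash_if_all_bridges) (auto simp: final_edges_tree)

lemma social_cost_tree:
  "social_cost n \<alpha> tree = ereal (2 * \<alpha> * real (n - 1) + real (sep_max n edges))"
  using social_cost_eq[of n tree \<alpha>] connected edges_nonempty essential_tree
  by (simp add: final_edges_tree essential_def card_requests)

end

section \<open>The star, an upper bound for the optimum\<close>

lemma star_social_cost:
  assumes "2 \<le> n"
  shows "\<exists>S. essential n S \<and> social_cost n \<alpha> S = ereal (2 * (\<alpha> + 1) * real (n - 1))"
proof -
  define p :: "nat \<Rightarrow> nat" where "p u = 1" for u
  interpret shallow_tree n p
    using assms by unfold_locales (auto simp: p_def)
  \<comment> \<open>Every edge cuts off one leaf, so all edges tie and separate
    \<open>2 * (n - 1)\<close> ordered pairs.\<close>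
  have "branch v = {v}" if "v \<in> {2..n}" for v
    using that by (auto simp: branch_def players_def p_def)
  then have "sep n edges {v, p v} = 2 * (n - 1)" if "v \<in> {2..n}" for v
    using sep_edge[OF that] that by simp
  then have "sep n edges e = 2 * (n - 1)" if "e \<in> edges" for e
    using that unfolding edges_def by blast
  then have "sep_max n edges = 2 * (n - 1)"
    unfolding sep_max_def using edges_nonempty by simp
  then have "social_cost n \<alpha> tree = ereal (2 * (\<alpha> + 1) * real (n - 1))"
    by (simp add: social_cost_tree algebra_simps)
  then show ?thesis
    using essential_tree by blast
qed


section \<open>The expensive equilibrium\<close>

text \<open>The extra vertex in the branch of 2 makes the adversary's target unique. Two branches of
  size \<open>b\<close> ensure that a link leaving the branch of 2 spares one of them. Root and
  branches occupy \<open>3 * b + 2\<close> vertices.\<close>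

locale three_branches = shallow_tree +
  fixes b :: nat
  assumes b_pos: "1 \<le> b" and b_le: "3 * b + 2 \<le> n"
    and card_branch_2: "card (branch 2) = b + 1"
    and card_branch_3: "card (branch 3) = b"
    and card_branch_4: "card (branch 4) = b"
    and card_branch_other: "\<And>v. 5 \<le> v \<Longrightarrow> v \<le> n \<Longrightarrow> card (branch v) \<le> b"
    and hubs: "p 2 = 1" "p 3 = 1" "p 4 = 1"
begin

section \<open>The critical edge and the effect of a new link\<close>

lemma hub_players: "2 \<in> {2..n}" "3 \<in> {2..n}" "4 \<in> {2..n}"
  using b_pos b_le by auto

lemma sep_critical: "sep n edges {2, 1} = 2 * (b + 1) * (n - (b + 1))"
  using sep_edge[OF hub_players(1)] by (simp add: hubs card_branch_2)

lemma critical_edge: "{2, 1} \<in> edges"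
  using imageI[OF hub_players(1), of "\<lambda>u. {u, p u}"] by (simp add: edges_def hubs(1))

lemma sep_less_critical:
  assumes "e \<in> edges" "e \<noteq> {2, 1}"
  shows "sep n edges e < sep n edges {2, 1}"
proof -
  obtain v where v: "e = {v, p v}" "v \<in> {2..n}"
    using assms(1) by (auto simp: edges_def)
  have "v \<noteq> 2"
    using assms(2) v(1) hubs(1) by auto
  then consider "v = 3" | "v = 4" | "5 \<le> v"
    using v(2) unfolding atLeastAtMost_iff by linarith
  then have "card (branch v) \<le> b"
    using v(2) card_branch_3 card_branch_4 card_branch_other by cases auto
  \<comment> \<open>The two sizes add up to at most \<open>2 * b + 1\<close>, which is less than
    \<open>n\<close>.\<close>
  then have "card (branch v) * (n - card (branch v)) < (b + 1) * (n - (b + 1))"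
    using b_le by (intro mult_diff_strict_mono) auto
  then show ?thesis
    unfolding sep_critical using sep_edge[OF v(2)] v(1) by simp
qed

lemma E_max_edges: "E_max n edges = {{2, 1}}"
  by (rule E_max_unique[OF edges_nonempty(1) critical_edge]) (rule sep_less_critical)

lemma sep_max_edges: "sep_max n edges = 2 * (b + 1) * (n - (b + 1))"
proof -
  have "{2, 1} \<in> E_max n edges"
    unfolding E_max_edges by (rule singletonI)
  then show ?thesis
    using sep_critical by (simp add: E_max_def)
qed

lemma disconnection_cost_edges:
  "disconnection_cost n edges u = ereal (real (relevance n edges {2, 1} u))"
  by (rule disconnection_cost_unique[OF connected E_max_edges])

text \<open>The link does not cross the critical cut, so the critical edge keeps its separation
  while that of every other tree edge can only drop. The adversary's target stays the same.\<close>

lemma disconnection_cost_same_side: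
  assumes vw: "v \<in> players n" "w \<in> players n" "{v, w} \<notin> edges"
    and side: "v \<in> branch 2 \<longleftrightarrow> w \<in> branch 2" and u: "u \<in> players n"
  shows "disconnection_cost n (insert {v, w} edges) u = disconnection_cost n edges u"
proof -
  let ?F = "insert {v, w} edges"
  have conn: "graph_connected n ?F"
    using connected by (rule graph_connected_mono) auto
  have closed: "y \<in> branch 2" if "{x, y} \<in> ?F - {{2, p 2}}" "x \<in> branch 2" for x y
  proof (cases "{x, y} = {v, w}")
    case True
    then show ?thesis
      using that(2) side by (auto simp: doubleton_eq_iff)
  next
    case False
    then show ?thesis
      using branch_closed[OF hub_players(1), of x y] that by blast
  qed
  have sep_F: "sep n ?F {2, 1} = sep n edges {2, 1}"
    using sep_branch[OF hub_players(1) subset_insertI closed] sep_critical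
    by (simp add: hubs card_branch_2)
  have rel_le: "relevance n ?F e x \<le> relevance n edges e x" if "x \<in> players n" for e x
    using that by (intro relevance_antimono connected) auto
  have "E_max n ?F = {{2, 1}}"
  proof (rule E_max_unique)
    fix f assume f: "f \<in> ?F" "f \<noteq> {2, 1}"
    show "sep n ?F f < sep n ?F {2, 1}"
    proof (cases "f = {v, w}")
      case True
      \<comment> \<open>Removing the new link gives back the connected tree, so it separates
        nothing.\<close>
      then have "?F - {f} = edges"
        using vw(3) by simp
      then have "(x, y) \<in> reach (?F - {f})" if "x \<in> players n" "y \<in> players n" for x y
        using connected that by (simp add: graph_connected_def)
      then have "sep n ?F f = 0"
        by (simp add: sep_def relevance_connected[OF conn])
      moreover have "0 < sep n edges {2, 1}"
        unfolding sep_critical using b_le by simp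
      ultimately show ?thesis
        using sep_F by simp
    next
      case False
      have "sep n ?F f \<le> sep n edges f"
        unfolding sep_def by (intro sum_mono rel_le)
      then show ?thesis
        using sep_less_critical[of f] f False sep_F by simp
    qed
  qed (use edges_nonempty critical_edge in auto)
  \<comment> \<open>No player's relevance grows, yet the sum is the same, so each one is
    unchanged.\<close>
  moreover have "relevance n ?F {2, 1} u = relevance n edges {2, 1} u"
    using sum_mono_inv[of "relevance n ?F {2, 1}" "players n" "relevance n edges {2, 1}" u]
      sep_F rel_le u by (simp add: sep_def)
  ultimately show ?thesis
    using disconnection_cost_unique[OF conn] disconnection_cost_edges by simp
qed

text \<open>A link across the critical edge meets at most one of the two branches of size \<open>b\<close>; the other
  one remains a target for the adversary.\<close>

lemma disconnection_cost_across:
  assumes vw: "v \<in> players n" "w \<in> players n"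
    and side: "v \<in> branch 2" "w \<notin> branch 2" and u: "u \<in> players n"
  shows "ereal (real b) \<le> disconnection_cost n (insert {v, w} edges) u"
proof -
  let ?F = "insert {v, w} edges"
  \<comment> \<open>The three branches are pairwise disjoint because their hubs are children of the
    root.\<close>
  have "v \<notin> branch 3" "v \<notin> branch 4" "w \<notin> branch 3 \<or> w \<notin> branch 4"
    using side hubs by (auto simp: branch_def)
  then obtain h where h: "h \<in> {2..n}" "v \<notin> branch h" "w \<notin> branch h" "card (branch h) = b"
    using hub_players card_branch_3 card_branch_4 by blast
  have closed: "y \<in> branch h" if "{x, y} \<in> ?F - {{h, p h}}" "x \<in> branch h" for x y
  proof (cases "{x, y} = {v, w}")
    case True
    then show ?thesis
      using that(2) h(2,3) by (auto simp: doubleton_eq_iff)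
  next
    case False
    then show ?thesis
      using branch_closed[OF h(1), of x y] that by blast
  qed
  have "sep n ?F {h, p h} = 2 * b * (n - b)"
    using sep_branch[OF h(1) subset_insertI closed] h(4) by simp
  moreover have "{h, p h} \<in> ?F"
    using h(1) by (auto simp: edges_def)
  moreover have "\<exists>x y. f = {x, y}" if "f \<in> ?F" for f
    using that by (auto simp: edges_def)
  ultimately show ?thesis
    using u b_le edges_nonempty graph_connected_mono[OF connected subset_insertI]
    by (intro disconnection_cost_ge[where e = "{h, p h}"]) auto
qed

lemma no_link_added_tree:
  assumes "1 < \<alpha>"
  shows "no_link_added n \<alpha> tree"
  unfolding no_link_added_def
proof (intro ballI impI)
  fix v w assume vw: "v \<in> players n" "w \<in> players n" "v \<noteq> w" "{v, w} \<notin> final_edges tree"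
  let ?T = "add_request (add_request tree v w) w v"
  assume le: "individual_cost n \<alpha> ?T v \<le> individual_cost n \<alpha> tree v"
  show "individual_cost n \<alpha> tree w < individual_cost n \<alpha> ?T w"
  proof (cases "v \<in> branch 2 \<longleftrightarrow> w \<in> branch 2")
    case True
    then have "disconnection_cost n (insert {v, w} edges) w = disconnection_cost n edges w"
      using disconnection_cost_same_side vw by (simp add: final_edges_tree)
    then show ?thesis
      using assms vw essential_tree disconnection_cost_edges[of w]
      by (intro individual_cost_add_link[where c = "real (relevance n edges {2, 1} w)"
            and d = "real (relevance n edges {2, 1} w)"])
        (auto simp: final_edges_tree)
  next
    case False
    \<comment> \<open>Outside the branch of 2 the cost drops from \<open>b + 1\<close> to no less
      than \<open>b\<close>, a gain of at most 1 for the price \<alpha>.\<close>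
    have loses: "individual_cost n \<alpha> tree u < individual_cost n \<alpha> ?T u"
      if u: "u \<in> {v, w}" "u \<notin> branch 2" for u
    proof (rule individual_cost_add_link[where c = "real b + 1" and d = "real b"])
      have "u \<in> players n"
        using u vw by auto
      then show "disconnection_cost n (final_edges tree) u \<le> ereal (real b + 1)"
        using relevance_outside[OF hub_players(1) _ u(2)]
        by (simp add: disconnection_cost_edges final_edges_tree hubs card_branch_2)
      show "ereal (real b) \<le> disconnection_cost n (insert {v, w} (final_edges tree)) u"
        using disconnection_cost_across[of v w u] disconnection_cost_across[of w v u] False u vw
        by (auto simp: final_edges_tree insert_commute)
    qed (use assms vw u essential_tree in auto)
    \<comment> \<open>If \<open>v\<close> is the endpoint outside, its loss contradicts the premise;
      otherwise \<open>w\<close> loses, as claimed.\<close>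
    then show ?thesis
      using False le by fastforce
  qed
qed

lemma pairwise_nash_tree: "1 < \<alpha> \<Longrightarrow> pairwise_nash n \<alpha> tree"
  using essential_tree nash_tree no_link_added_tree by (simp add: pairwise_nash_def)

end

section \<open>An explicit tree with quadratic separation\<close>

lemma expensive_equilibrium:
  assumes "9 \<le> n" "1 < \<alpha>"
  shows "\<exists>S. pairwise_nash n \<alpha> S \<and>
    ereal (2 * \<alpha> * real (n - 1) + (real n)\<^sup>2 / 4) \<le> social_cost n \<alpha> S"
proof -
  \<comment> \<open>The largest \<open>b\<close> for which root and branches fit; at most two
    vertices remain and become leaves at the root.\<close>
  define b where "b = (n - 2) div 3"
  have b: "2 \<le> b" "3 * b + 2 \<le> n" "n \<le> 3 * b + 4"
    using assms(1) by (auto simp: b_def)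
  \<comment> \<open>The hubs are 2, 3 and 4. The first receives \<open>b\<close> children, each of
    the other two \<open>b - 1\<close>.\<close>
  define p :: "nat \<Rightarrow> nat" where
    "p u = (if u < 5 \<or> 3 * b + 2 < u then 1 else if u \<le> b + 4 then 2
      else if u \<le> 2 * b + 3 then 3 else 4)" for u
  interpret shallow_tree n p
    using assms b by unfold_locales (auto simp: p_def)
  have branch_2: "branch 2 = {2} \<union> {5..b + 4}"
    using b by (auto simp: branch_def players_def p_def split: if_splits)
  have branch_3: "branch 3 = {3} \<union> {b + 5..2 * b + 3}"
    using b by (auto simp: branch_def players_def p_def split: if_splits)
  have branch_4: "branch 4 = {4} \<union> {2 * b + 4..3 * b + 2}"
    using b by (auto simp: branch_def players_def p_def split: if_splits)
  have branch_other: "branch v = {v}" if "5 \<le> v" "v \<le> n" for v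
    using that b by (auto simp: branch_def players_def p_def split: if_splits)
  interpret three_branches n p b
  proof
    show "card (branch 2) = b + 1" "card (branch 3) = b" "card (branch 4) = b"
      unfolding branch_2 branch_3 branch_4 using b by (subst card_Un_disjoint; auto)+
  qed (use b branch_other in \<open>auto simp: p_def\<close>)
  \<comment> \<open>Both factors are at least \<open>n\<close>: \<open>n \<le> 3 * b + 4\<close>
    gives the first, and \<open>2 * (b + 1) \<le> 3 * b + 2 \<le> n\<close> the second.\<close>
  have "n * n \<le> (4 * (b + 1)) * (2 * (n - (b + 1)))"
    using assms(1) b by (intro mult_mono) auto
  also have "\<dots> = 4 * sep_max n edges"
    unfolding sep_max_edges by (simp only: ac_simps)
  finally have "real (n * n) \<le> real (4 * sep_max n edges)"
    by (rule of_nat_mono)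
  then have "(real n)\<^sup>2 / 4 \<le> real (sep_max n edges)"
    by (simp add: power2_eq_square)
  then show ?thesis
    using pairwise_nash_tree[OF assms(2)] social_cost_tree[of \<alpha>] by auto
qed

theorem theorem10p10:
  "\<exists>c::real. c > 0 \<and>
     (\<forall>(n::nat) (\<alpha>::real). n \<ge> 9 \<longrightarrow> \<alpha> > 2 \<longrightarrow>
        price_of_anarchy pairwise_nash n \<alpha> \<ge> ereal (c * (1 + real n / \<alpha>)) \<and>
        price_of_anarchy pairwise_stable n \<alpha> \<ge> ereal (c * (1 + real n / \<alpha>)))"
proof (intro exI[of _ "1 / 12 :: real"] conjI allI impI)
  fix n :: nat and \<alpha> :: real
  assume n: "9 \<le> n" and \<alpha>: "2 < \<alpha>"
  \<comment> \<open>Simple bounds for the equilibrium and for the star, with quotient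
    \<open>(\<alpha> + n) / (12 * \<alpha>)\<close>; this is the origin of the constant
    1/12.\<close>
  define C where "C = real n * (\<alpha> + real n) / 4"
  define D where "D = 3 * \<alpha> * real n"
  obtain S where S: "pairwise_nash n \<alpha> S"
    "ereal (2 * \<alpha> * real (n - 1) + (real n)\<^sup>2 / 4) \<le> social_cost n \<alpha> S"
    using expensive_equilibrium[of n \<alpha>] n \<alpha> by auto
  have "\<alpha> * real n \<le> \<alpha> * (8 * real (n - 1))"
    using n \<alpha> by (intro mult_left_mono) auto
  then have "C \<le> 2 * \<alpha> * real (n - 1) + (real n)\<^sup>2 / 4"
    by (simp add: C_def field_simps power2_eq_square)
  then have cost_S: "ereal C \<le> social_cost n \<alpha> S"
    using S(2) by (meson ereal_less_eq(3) order_trans)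
  obtain T where T: "essential n T" "social_cost n \<alpha> T = ereal (2 * (\<alpha> + 1) * real (n - 1))"
    using star_social_cost[of n \<alpha>] n by auto
  \<comment> \<open>Here \<alpha> > 2 enters, through
    \<open>2 * (\<alpha> + 1) \<le> 3 * \<alpha>\<close>.\<close>
  have "2 * (\<alpha> + 1) * real (n - 1) \<le> (3 * \<alpha>) * real n"
    using \<alpha> by (intro mult_mono[where 'a = real and b = "3 * \<alpha>"]) auto
  then have cost_T: "social_cost n \<alpha> T \<le> ereal D"
    by (simp add: T(2) D_def)
  have pos: "0 < \<alpha>" "0 \<le> C" "0 < D"
    using n \<alpha> by (auto simp: C_def D_def)
  have "real n \<noteq> 0" "\<alpha> \<noteq> 0"
    using n \<alpha> by auto
  then have "1 / 12 * (1 + real n / \<alpha>) = C / D"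
    by (simp add: C_def D_def field_simps)
  then show "ereal (1 / 12 * (1 + real n / \<alpha>)) \<le> price_of_anarchy pairwise_nash n \<alpha>"
    "ereal (1 / 12 * (1 + real n / \<alpha>)) \<le> price_of_anarchy pairwise_stable n \<alpha>"
    using price_of_anarchy_ge[OF _ cost_S T(1) cost_T pos] S(1) pairwise_nash_imp_stable by auto
qed simp

end
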